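(* For all integers $m\ge 1$ and $n\ge 2$, $$\psi_{sq}(K_m+\overline{K_n})=n.$$
   Context: All graphs are finite, simple and undirected. $K_m$ is the complete graph on $m$ vertices and $\overline{K_n}$ the edgeless graph on $n$ vertices. The join $G+H$ is obtained from the disjoint union of $G$ and $H$ by adding every edge between $V(G)$ and $V(H)$. $N_G[v]$ denotes the closed neighborhood of $v$ in $G$. A sub-quorum coloring of $G$ with $k$ colors is an onto partial map $f:V(G)\dashrightarrow\{1,\ldots,k\}$ such that, with $S=\operatorname{dom}(f)$, every $v\in S$ satisfies $|\{u\in N_G[v]\cap S: f(u)=f(v)\}|\ge\frac12|N_G[v]\cap S|$; $\psi_{sq}(G)$ is the maximum such $k$. *)

theory Defs
  imports Complex_Main "Graph_Theory.Graph_Theory"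
begin

text \<open>
  Finite simple undirected graphs are the symmetric, loop-free, finite digraphs without
  parallel arcs of the locale \<^locale>\<open>pair_graph\<close>: an undirected edge between \<open>u\<close> and \<open>v\<close> is
  the pair of arcs \<open>(u, v)\<close>, \<open>(v, u)\<close>. Complete graphs are given by
  \<^const>\<open>complete_digraph\<close>; the next predicate is its edgeless counterpart.
\<close>

definition edgeless_graph :: "nat \<Rightarrow> 'a pair_pre_digraph \<Rightarrow> bool" where
  "edgeless_graph n G \<longleftrightarrow> pair_graph G \<and> card (pverts G) = n \<and> parcs G = {}"

definition graph_join ::
  "'a pair_pre_digraph \<Rightarrow> 'b pair_pre_digraph \<Rightarrow> ('a + 'b) pair_pre_digraph" where
  "graph_join G H =
    \<lparr> pverts = pverts G <+> pverts H,
      parcs = {(Inl u, Inl v) | u v. (u, v) \<in> parcs G}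
            \<union> {(Inr u, Inr v) | u v. (u, v) \<in> parcs H}
            \<union> {(Inl u, Inr v) | u v. u \<in> pverts G \<and> v \<in> pverts H}
            \<union> {(Inr v, Inl u) | u v. u \<in> pverts G \<and> v \<in> pverts H} \<rparr>"

lemma pair_graph_graph_join:
  assumes "pair_graph G" and "pair_graph H"
  shows "pair_graph (graph_join G H)"
proof -
  interpret G: pair_graph G by fact
  interpret H: pair_graph H by fact
  have sG: "sym (parcs G)" and sH: "sym (parcs H)"
    using G.pair_sym_arcs H.pair_sym_arcs by (simp_all add: symmetric_def)
  let ?V = "pverts G <+> pverts H"
  have sub: "parcs (graph_join G H) \<subseteq> ?V \<times> ?V"
    by (auto simp: graph_join_def intro: G.wellformed' H.wellformed')
  have fin: "finite (parcs (graph_join G H))"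
    by (rule finite_subset[OF sub]) (simp add: G.pair_finite_verts H.pair_finite_verts)
  have sym: "sym (parcs (graph_join G H))"
    using sG sH by (auto simp: graph_join_def sym_def)
  have verts: "pverts (graph_join G H) = ?V"
    by (simp add: graph_join_def)
  have no_loops: "fst e \<noteq> snd e" if "e \<in> parcs (graph_join G H)" for e
    using that by (auto simp: graph_join_def dest: G.pair_no_loops H.pair_no_loops)
  show ?thesis
  proof unfold_locales
    fix e assume e: "e \<in> parcs (graph_join G H)"
    then have "e \<in> ?V \<times> ?V" using sub by blast
    then show "fst e \<in> pverts (graph_join G H)" "snd e \<in> pverts (graph_join G H)"
      unfolding verts by (simp_all add: mem_Times_iff)
    show "fst e \<noteq> snd e" using e by (rule no_loops)
  next
    show "finite (pverts (graph_join G H))"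
      unfolding verts by (simp add: G.pair_finite_verts H.pair_finite_verts)
    show "finite (parcs (graph_join G H))" by (rule fin)
    show "symmetric (with_proj (graph_join G H))" using sym by (simp add: symmetric_def)
  qed
qed

definition closed_neighborhood :: "'a pair_pre_digraph \<Rightarrow> 'a \<Rightarrow> 'a set" where
  "closed_neighborhood G v = insert v {u. (v, u) \<in> parcs G}"

definition sub_quorum_coloring ::
  "'a pair_pre_digraph \<Rightarrow> nat \<Rightarrow> ('a \<rightharpoonup> nat) \<Rightarrow> bool" where
  "sub_quorum_coloring G k f \<longleftrightarrow>
    dom f \<subseteq> pverts G \<and> ran f = {1..k} \<and>
    (\<forall>v \<in> dom f.
      real (card {u \<in> closed_neighborhood G v \<inter> dom f. f u = f v})
        \<ge> 1 / 2 * real (card (closed_neighborhood G v \<inter> dom f)))"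

definition psi_sq :: "'a pair_pre_digraph \<Rightarrow> nat" where
  "psi_sq G = Max {k. \<exists>f. sub_quorum_coloring G k f}"

text \<open>
  On a finite vertex set the maximum is over a finite nonempty set of numbers (the empty
  partial map witnesses \<open>k = 0\<close>), so \<^const>\<open>psi_sq\<close> is a genuine, attained maximum.
\<close>

lemma sub_quorum_coloring_le_card:
  assumes "finite (pverts G)" and "sub_quorum_coloring G k f"
  shows "k \<le> card (pverts G)"
proof -
  have dom: "dom f \<subseteq> pverts G" and ran: "ran f = {1..k}"
    using assms(2) by (auto simp: sub_quorum_coloring_def)
  have "ran f = (the \<circ> f) ` dom f" by (force simp: ran_def dom_def image_iff)
  then have "card (ran f) \<le> card (dom f)"
    using finite_subset[OF dom assms(1)] by (simp add: card_image_le)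
  also have "\<dots> \<le> card (pverts G)" using dom assms(1) by (rule card_mono[rotated])
  finally show ?thesis using ran by simp
qed

lemma finite_sub_quorum_numbers:
  assumes "finite (pverts G)"
  shows "finite {k. \<exists>f. sub_quorum_coloring G k f}"
  by (rule finite_subset[of _ "{..card (pverts G)}"])
    (auto dest: sub_quorum_coloring_le_card[OF assms])

lemma sub_quorum_coloring_empty: "sub_quorum_coloring G 0 Map.empty"
  by (simp add: sub_quorum_coloring_def)

end

theory Submission
  imports Defs
begin

text \<open>
  Colouring the \<open>n\<close> independent vertices with \<open>n\<close> different colours and leaving the clique
  uncoloured is legal, because each coloured vertex then sees no coloured vertex but itself.

  For the upper bound, let \<open>S\<close> be the set of vertices coloured by a legal colouring with \<open>k\<close>
  colours. If no clique vertex is coloured, then \<open>k \<le> card S \<le> n\<close>. Otherwise some coloured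
  clique vertex \<open>a\<close> is adjacent to every other coloured vertex, so the colour class of \<open>a\<close>
  fills at least half of \<open>S\<close>. This has two consequences.

  If two coloured clique vertices have different colours, their two classes exhaust \<open>S\<close>, and
  \<open>k \<le> 2 \<le> n\<close> (\<open>colors_le_two_if_dominating_differ\<close>).

  If all coloured clique vertices share one colour and a second colour exists, then a vertex
  of the second colour is independent and is alone with its colour in its closed
  neighbourhood. This neighbourhood therefore has at most two coloured vertices, so \<open>a\<close> is the
  only coloured clique vertex and \<open>card S \<le> n + 1\<close>. The other \<open>k - 1\<close> colours have to fit
  into the half of \<open>S\<close> that the class of \<open>a\<close> leaves free, which gives \<open>2 * (k - 1) \<le> n + 1\<close>
  (\<open>two_times_colors_le_if_dominating\<close>), and \<open>k \<le> n\<close> follows from \<open>n \<ge> 2\<close>.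
\<close>

lemma finite_pverts:
  assumes "pair_graph G"
  shows "finite (pverts G)"
proof -
  interpret pair_graph G by fact
  show ?thesis by (rule pair_finite_verts)
qed

lemma card_colors:
  assumes "sub_quorum_coloring G k f"
  shows "card (f ` dom f) = k"
proof -
  have "f ` dom f = Some ` ran f"
    by (force simp: ran_def dom_def image_iff)
  then show ?thesis
    using assms by (simp add: card_image sub_quorum_coloring_def)
qed

lemma quorum_at:
  assumes "sub_quorum_coloring G k f" and "v \<in> dom f"
  shows "card (closed_neighborhood G v \<inter> dom f)
    \<le> 2 * card {u \<in> closed_neighborhood G v \<inter> dom f. f u = f v}"
proof -
  have "1 / 2 * real (card (closed_neighborhood G v \<inter> dom f))
      \<le> real (card {u \<in> closed_neighborhood G v \<inter> dom f. f u = f v})"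
    using assms unfolding sub_quorum_coloring_def by blast
  then show ?thesis
    by linarith
qed

lemma card_dom_le_twice_dominating_class:
  assumes "sub_quorum_coloring G k f" and "v \<in> dom f"
    and "dom f \<subseteq> closed_neighborhood G v"
  shows "card (dom f) \<le> 2 * card {u \<in> dom f. f u = f v}"
  using quorum_at[OF assms(1,2)] assms(3) by (simp add: Int_absorb1)

text \<open>
  At least half of the coloured vertices have the colour of a dominating vertex, and each of
  the other colours occurs among the remaining ones.
\<close>

lemma two_times_colors_le_if_dominating:
  assumes col: "sub_quorum_coloring G k f" and "finite (dom f)"
    and "v \<in> dom f" and "dom f \<subseteq> closed_neighborhood G v"
  shows "2 * k \<le> card (dom f) + 2"
proof -
  let ?C = "{u \<in> dom f. f u = f v}"
  have "f ` dom f \<subseteq> insert (f v) (f ` (dom f - ?C))"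
    by auto
  then have "k \<le> card (insert (f v) (f ` (dom f - ?C)))"
    unfolding card_colors[OF col, symmetric] using assms(2) by (intro card_mono) auto
  also have "\<dots> \<le> Suc (card (dom f - ?C))"
    using assms(2) card_insert_le_m1[of "Suc (card (dom f - ?C))"] card_image_le[of "dom f - ?C" f]
    by simp
  also have "card (dom f - ?C) = card (dom f) - card ?C"
    using assms(2) by (intro card_Diff_subset) auto
  finally show ?thesis
    using card_dom_le_twice_dominating_class[OF col assms(3,4)] by linarith
qed

text \<open>
  Two disjoint classes that each contain at least half of the coloured vertices leave no room
  for a third.
\<close>

lemma colors_le_two_if_dominating_differ:
  assumes col: "sub_quorum_coloring G k f" and fin: "finite (dom f)"
    and "v \<in> dom f" and "dom f \<subseteq> closed_neighborhood G v"
    and "w \<in> dom f" and "dom f \<subseteq> closed_neighborhood G w"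
    and "f v \<noteq> f w"
  shows "k \<le> 2"
proof -
  let ?C = "{u \<in> dom f. f u = f v}" and ?D = "{u \<in> dom f. f u = f w}"
  have "card (?C \<union> ?D) = card ?C + card ?D"
    using fin assms(7) by (intro card_Un_disjoint) auto
  then have "card (dom f) \<le> card (?C \<union> ?D)"
    using card_dom_le_twice_dominating_class[OF col assms(3,4)]
      card_dom_le_twice_dominating_class[OF col assms(5,6)] by linarith
  then have "?C \<union> ?D = dom f"
    using fin by (intro card_seteq) auto
  then have "f ` dom f \<subseteq> {f v, f w}"
    by blast
  then have "card (f ` dom f) \<le> card {f v, f w}"
    by (intro card_mono) auto
  also have "\<dots> \<le> 2"
    by (simp add: card_insert_if)
  finally show ?thesis
    using card_colors[OF col] by simp
qed

lemma closed_neighborhood_join_Inl: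
  assumes "complete_digraph m (with_proj G)" and "a \<in> pverts G"
  shows "closed_neighborhood (graph_join G H) (Inl a) = pverts (graph_join G H)"
proof -
  have "(a, u) \<in> parcs G \<longleftrightarrow> u \<in> pverts G \<and> u \<noteq> a" for u
    using assms by (auto simp: complete_digraph_def)
  then show ?thesis
    using assms(2) by (auto simp: closed_neighborhood_def graph_join_def)
qed

lemma closed_neighborhood_join_Inr:
  assumes "edgeless_graph n H" and "b \<in> pverts H"
  shows "closed_neighborhood (graph_join G H) (Inr b) = insert (Inr b) (Inl ` pverts G)"
  using assms by (auto simp: edgeless_graph_def closed_neighborhood_def graph_join_def)

text \<open>
  With the clique left uncoloured, no two coloured vertices are adjacent, so the independent
  vertices can have pairwise different colours.
\<close>

lemma sub_quorum_coloring_join_edgeless: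
  fixes G :: "'a pair_pre_digraph" and H :: "'b pair_pre_digraph"
  assumes H: "edgeless_graph n H"
  shows "\<exists>f. sub_quorum_coloring (graph_join G H) n f"
proof -
  have "finite (pverts H)" and "card (pverts H) = n"
    using H by (simp_all add: edgeless_graph_def finite_pverts)
  then obtain h where h: "bij_betw h (pverts H) {1..n}"
    using finite_same_card_bij[of "pverts H" "{1..n}"] by auto
  define f where
    "f v = (if v \<in> Inr ` pverts H then Some (h (projr v)) else None)" for v :: "'a + 'b"
  have dom: "dom f = Inr ` pverts H"
    by (auto simp: f_def dom_def)
  have "h b \<in> ran f" if "b \<in> pverts H" for b
    using that by (intro ranI[of f "Inr b"]) (simp add: f_def)
  moreover have "ran f \<subseteq> h ` pverts H"
    by (auto simp: ran_def f_def split: if_splits)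
  ultimately have "ran f = h ` pverts H"
    by blast
  then have ran: "ran f = {1..n}"
    using h by (simp add: bij_betw_def)
  have alone: "closed_neighborhood (graph_join G H) v \<inter> dom f = {v}" if "v \<in> dom f" for v
    using that by (auto simp: dom closed_neighborhood_join_Inr[OF H])
  have "sub_quorum_coloring (graph_join G H) n f"
    unfolding sub_quorum_coloring_def
  proof (intro conjI ballI)
    show "dom f \<subseteq> pverts (graph_join G H)"
      by (auto simp: dom graph_join_def)
    fix v assume "v \<in> dom f"
    moreover have "{u \<in> {v}. f u = f v} = {v}"
      by auto
    ultimately show "1 / 2 * real (card (closed_neighborhood (graph_join G H) v \<inter> dom f))
        \<le> real (card {u \<in> closed_neighborhood (graph_join G H) v \<inter> dom f. f u = f v})"
      by (simp add: alone)
  qed (rule ran)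
  then show ?thesis
    by blast
qed

text \<open>
  Coloured clique vertices dominate all coloured vertices, so the two bounds for dominating
  vertices apply as soon as the clique is not entirely uncoloured.
\<close>

lemma colors_le_join_complete_edgeless:
  assumes "n \<ge> 2" and G: "complete_digraph m (with_proj G)" and H: "edgeless_graph n H"
    and col: "sub_quorum_coloring (graph_join G H) k f"
  shows "k \<le> n"
proof -
  let ?J = "graph_join G H"
  define A where "A = {a \<in> pverts G. Inl a \<in> dom f}"
  define B where "B = {b \<in> pverts H. Inr b \<in> dom f}"
  have finG: "finite (pverts G)"
  proof -
    interpret graph "with_proj G"
      using G by (simp add: complete_digraph_def)
    show ?thesis
      using finite_verts by simp
  qed
  have finH: "finite (pverts H)" and cardH: "card (pverts H) = n"
    using H by (simp_all add: edgeless_graph_def finite_pverts)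
  have sub: "dom f \<subseteq> pverts ?J"
    using col by (simp add: sub_quorum_coloring_def)
  have dom: "dom f = Inl ` A \<union> Inr ` B"
  proof (rule set_eqI)
    fix v show "v \<in> dom f \<longleftrightarrow> v \<in> Inl ` A \<union> Inr ` B"
      using subsetD[OF sub, of v]
      by (cases v) (auto simp: A_def B_def graph_join_def)
  qed
  have subA: "A \<subseteq> pverts G" and subB: "B \<subseteq> pverts H"
    by (auto simp: A_def B_def)
  then have fin: "finite A" "finite B" "finite (dom f)"
    using finG finH unfolding dom by (auto intro: finite_subset)
  have "card B \<le> n"
    using card_mono[OF finH subB] cardH by simp
  moreover have "card (dom f) = card A + card B"
    unfolding dom using fin by (subst card_Un_disjoint) (auto simp: card_image)
  ultimately have card_dom: "card (dom f) \<le> card A + n"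
    by simp
  have dominates: "dom f \<subseteq> closed_neighborhood ?J (Inl a)" if "a \<in> A" for a
    using that sub subA by (simp add: closed_neighborhood_join_Inl[OF G] subsetD)
  consider (no_clique) "A = {}"
    | (two_clique) a a' where "a \<in> A" "a' \<in> A" "f (Inl a) \<noteq> f (Inl a')"
    | (one_clique) a where "a \<in> A" "\<forall>a' \<in> A. f (Inl a') = f (Inl a)"
    by blast
  then show ?thesis
  proof cases
    case no_clique
    have "k \<le> card (dom f)"
      using card_colors[OF col] card_image_le[OF fin(3), of f] by simp
    then show ?thesis
      using card_dom no_clique by simp
  next
    case two_clique
    then have "k \<le> 2"
      by (intro colors_le_two_if_dominating_differ[OF col fin(3) _ dominates _ dominates])
        (simp_all add: dom)
    then show ?thesis
      using assms(1) by simp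
  next
    case one_clique
    show ?thesis
    proof (cases "\<exists>b \<in> B. f (Inr b) \<noteq> f (Inl a)")
      case True
      then obtain b where b: "b \<in> B" "f (Inr b) \<noteq> f (Inl a)"
        by blast
      \<comment> \<open>No neighbour of \<open>b\<close> shares its colour, so the quorum at \<open>b\<close> bounds \<open>A\<close>.\<close>
      have nbhd: "closed_neighborhood ?J (Inr b) \<inter> dom f = insert (Inr b) (Inl ` A)"
        unfolding closed_neighborhood_join_Inr[OF H subsetD[OF subB b(1)]] dom
        using b(1) subA by auto
      have "{u \<in> insert (Inr b) (Inl ` A). f u = f (Inr b)} = {Inr b}"
        using b(2) one_clique(2) by auto
      moreover have "card (insert (Inr b) (Inl ` A)) = Suc (card A)"
        using fin(1) by (subst card_insert_disjoint) (auto simp: card_image)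
      ultimately have "card A \<le> 1"
        using quorum_at[OF col, of "Inr b"] b(1) unfolding nbhd by (simp add: dom)
      moreover have "2 * k \<le> card (dom f) + 2"
        using one_clique(1)
        by (intro two_times_colors_le_if_dominating[OF col fin(3) _ dominates])
          (simp_all add: dom)
      ultimately show ?thesis
        using card_dom assms(1) by linarith
    next
      case False
      then have "f ` dom f \<subseteq> {f (Inl a)}"
        unfolding dom using one_clique(2) by blast
      then have "k \<le> 1"
        using card_colors[OF col] card_mono[of "{f (Inl a)}" "f ` dom f"] by simp
      then show ?thesis
        using assms(1) by simp
    qed
  qed
qed

theorem theorem5p15:
  fixes m n :: nat
    and G :: "'a pair_pre_digraph" and H :: "'b pair_pre_digraph"
  assumes "m \<ge> 1" and "n \<ge> 2"
    and "complete_digraph m (with_proj G)"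
    and "edgeless_graph n H"
  shows "psi_sq (graph_join G H) = n"
  unfolding psi_sq_def
proof (rule Max_eqI)
  show bound: "k \<le> n" if "k \<in> {k. \<exists>f. sub_quorum_coloring (graph_join G H) k f}" for k
    using that colors_le_join_complete_edgeless[OF assms(2-4)] by blast
  show "finite {k. \<exists>f. sub_quorum_coloring (graph_join G H) k f}"
    by (rule finite_subset[of _ "{..n}"]) (blast intro: bound, simp)
  show "n \<in> {k. \<exists>f. sub_quorum_coloring (graph_join G H) k f}"
    using sub_quorum_coloring_join_edgeless[OF assms(4)] by simp
qed

end
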